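(* Let $\lambda/\mu$ be a connected skew shape with $\mu\neq\emptyset$, let $d=\ell(\lambda)$ and $r=\max\{i\mid \mu_i=\mu_1\}$. Then $\mathrm{ED}(\lambda/\mu)\le\mathrm{OOT}(\lambda/\mu)$, with equality if and only if $\lambda_d\ge\mu_r+d-r$.
   Context: $[\lambda]=\{(i,j):1\le i\le\ell(\lambda),1\le j\le\lambda_i\}$ (English convention). Excited diagrams: for $D\subseteq[\lambda]$ a cell $(i,j)\in D$ is active if $(i+1,j),(i,j+1),(i+1,j+1)\in[\lambda]\setminus D$; the excited move replaces such $(i,j)$ by $(i+1,j+1)$. $\mathcal{E}(\lambda/\mu)$ is the set of subsets of $[\lambda]$ obtained from $[\mu]$ by finite sequences of excited moves, and $\mathrm{ED}(\lambda/\mu)=|\mathcal{E}(\lambda/\mu)|$. With $d=\ell(\lambda)$, an Okounkov–Olshanski tableau is an SSYT $T$ of shape $\mu$ (entries weakly increasing in rows, strictly down columns) with entries in $\{1,\dots,d\}$ such that $j-i<\lambda_{d+1-T(i,j)}$ for all $(i,j)\in[\mu]$; $\mathrm{OOT}(\lambda/\mu)$ is the number of such tableaux.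
   Formalization: "Connected" is taken to mean that the cells of λ/μ are edge-connected and that the last row of λ contains a cell of λ/μ (μ_d < λ_d); with edge-connectedness alone the equality criterion fails, e.g. for λ=(3,1), μ=(2,1). *)

theory Defs
  imports Main "HOL-Library.FuncSet"
begin

type_synonym cell = "nat \<times> nat"

definition is_partition :: "nat list \<Rightarrow> bool" where
  "is_partition p \<longleftrightarrow> sorted_wrt (\<ge>) p \<and> (\<forall>x \<in> set p. 0 < x)"

text \<open>Parts are indexed from 1 and vanish beyond the length, which is \<^term>\<open>length p\<close>.\<close>

definition part :: "nat list \<Rightarrow> nat \<Rightarrow> nat" where
  "part p i = (if 1 \<le> i \<and> i \<le> length p then p ! (i - 1) else 0)"

definition diagram :: "nat list \<Rightarrow> cell set" where
  "diagram p = {(i, j). 1 \<le> i \<and> i \<le> length p \<and> 1 \<le> j \<and> j \<le> part p i}"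

definition skew_shape :: "nat list \<Rightarrow> nat list \<Rightarrow> bool" where
  "skew_shape lam mu \<longleftrightarrow>
     is_partition lam \<and> is_partition mu \<and> diagram mu \<subseteq> diagram lam"

definition skew_diagram :: "nat list \<Rightarrow> nat list \<Rightarrow> cell set" where
  "skew_diagram lam mu = diagram lam - diagram mu"

definition edge_adjacent :: "cell \<Rightarrow> cell \<Rightarrow> bool" where
  "edge_adjacent c c' \<longleftrightarrow>
     \<bar>int (fst c) - int (fst c')\<bar> + \<bar>int (snd c) - int (snd c')\<bar> = 1"

definition connected_cells :: "cell set \<Rightarrow> bool" where
  "connected_cells S \<longleftrightarrow>
     (\<forall>c \<in> S. \<forall>c' \<in> S. (c, c') \<in> {(a, b). a \<in> S \<and> b \<in> S \<and> edge_adjacent a b}\<^sup>*)"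

definition active :: "nat list \<Rightarrow> cell set \<Rightarrow> nat \<Rightarrow> nat \<Rightarrow> bool" where
  "active lam D i j \<longleftrightarrow>
     (i, j) \<in> D \<and> {(i + 1, j), (i, j + 1), (i + 1, j + 1)} \<subseteq> diagram lam - D"

inductive_set excited_diagrams :: "nat list \<Rightarrow> nat list \<Rightarrow> cell set set"
  for lam mu :: "nat list" where
  start: "diagram mu \<in> excited_diagrams lam mu"
| move: "D \<in> excited_diagrams lam mu \<Longrightarrow> active lam D i j \<Longrightarrow>
     insert (i + 1, j + 1) (D - {(i, j)}) \<in> excited_diagrams lam mu"

definition ED :: "nat list \<Rightarrow> nat list \<Rightarrow> nat" where
  "ED lam mu = card (excited_diagrams lam mu)"

definition semistandard :: "nat list \<Rightarrow> (cell \<Rightarrow> nat) \<Rightarrow> bool" where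
  "semistandard mu T \<longleftrightarrow>
     (\<forall>i j j'. (i, j) \<in> diagram mu \<and> (i, j') \<in> diagram mu \<and> j < j' \<longrightarrow> T (i, j) \<le> T (i, j')) \<and>
     (\<forall>i i' j. (i, j) \<in> diagram mu \<and> (i', j) \<in> diagram mu \<and> i < i' \<longrightarrow> T (i, j) < T (i', j))"

text \<open>Tableaux are taken extensional (\<open>undefined\<close> outside the diagram), so that each
  filling of the diagram is represented by exactly one function and counted once.\<close>

definition OO_tableaux :: "nat list \<Rightarrow> nat list \<Rightarrow> (cell \<Rightarrow> nat) set" where
  "OO_tableaux lam mu =
     {T \<in> diagram mu \<rightarrow>\<^sub>E {1..length lam}. semistandard mu T \<and>
        (\<forall>(i, j) \<in> diagram mu. int j - int i < int (part lam (length lam + 1 - T (i, j))))}"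

definition OOT :: "nat list \<Rightarrow> nat list \<Rightarrow> nat" where
  "OOT lam mu = card (OO_tableaux lam mu)"

text \<open>A connected skew shape: \<^const>\<open>connected_cells\<close> only sees the set of cells, which does not
  determine the pair of partitions. The last row of \<open>lam\<close> is required to contain a cell of the
  skew diagram, so that \<^term>\<open>length lam\<close> is the index of the last row the shape occupies. This is
  weaker than asking that consecutive rows overlap (\<open>part mu i < part lam (i + 1)\<close>) or that no row
  be empty, and it cannot be dropped in the comparison of \<^const>\<open>ED\<close> with \<^const>\<open>OOT\<close>:
  for \<open>lam = [3, 1]\<close>, \<open>mu = [2, 1]\<close> the skew diagram is a single cell and both counts are 1,
  although \<open>part lam 2 = 1 < 2 + 2 - 1\<close>.\<close>

definition connected_skew_shape :: "nat list \<Rightarrow> nat list \<Rightarrow> bool" where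
  "connected_skew_shape lam mu \<longleftrightarrow>
     skew_shape lam mu \<and> connected_cells (skew_diagram lam mu) \<and>
     part mu (length lam) < part lam (length lam)"

end

theory Submission
  imports Defs
begin

text \<open>Recording the row to which each cell of \<open>mu\<close> has moved identifies excited diagrams with
  the semistandard tableaux of shape \<open>mu\<close> satisfying \<open>j - i \<le> part lam t - t\<close> whenever
  \<open>t = T (i, j)\<close>. This confines the entry \<open>t\<close> to the first \<open>b t\<close> columns, for some
  weakly decreasing \<open>b\<close>. A tableau is a chain of horizontal strips, and exchanging the limits of two
  neighbouring strips, so that the larger limit moves to the outer one, does not decrease the
  number of chains. Hence there are at most as many tableaux limited by \<open>b\<close> as tableaux limited
  by \<open>\<lambda>t. b (d + 1 - t)\<close>, and since \<open>b t \<le> part lam t\<close> the latter are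
  Okounkov--Olshanski tableaux. The entrywise smallest Okounkov--Olshanski tableau is missed
  unless \<open>lam\<close> satisfies the inequality of the theorem, in which case both conditions on
  tableaux are vacuous.\<close>

text \<open>A finite down-closed set of positive integers is the interval from 1 to its maximum, so
  its cardinality serves as a threshold. This applies below to row prefixes, column limits and
  column heights.\<close>

lemma mem_downset_iff_le_card:
  fixes J :: "nat set"
  assumes "finite J" and "\<And>j. j \<in> J \<Longrightarrow> 1 \<le> j"
    and down: "\<And>j j'. j \<in> J \<Longrightarrow> 1 \<le> j' \<Longrightarrow> j' \<le> j \<Longrightarrow> j' \<in> J"
  shows "j \<in> J \<longleftrightarrow> 1 \<le> j \<and> j \<le> card J"
proof (cases "J = {}")
  case False
  have J: "J = {1..Max J}"
  proof
    show "J \<subseteq> {1..Max J}"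
      using assms(1,2) by auto
    show "{1..Max J} \<subseteq> J"
      using down[OF Max_in[OF assms(1) False]] by auto
  qed
  have "card J = Max J"
    by (subst J) simp
  then show ?thesis
    by (subst J) simp
qed simp

section \<open>Horizontal strips with column limits\<close>

text \<open>Rows are indexed from 1; fixing \<open>m 0 = 0\<close> makes
  \<open>\<lambda>_. 0\<close> the only empty partition.\<close>

definition partition_fun :: "(nat \<Rightarrow> nat) \<Rightarrow> bool" where
  "partition_fun m \<longleftrightarrow> m 0 = 0 \<and> (\<forall>i\<ge>1. m (Suc i) \<le> m i) \<and> finite {i. m i \<noteq> 0}"

text \<open>The skew shape \<open>m / k\<close> is a horizontal strip inside the first
  \<open>y\<close> columns: a row may lose cells only if its last column is at most
  \<open>y\<close>.\<close>

definition strips :: "nat \<Rightarrow> (nat \<Rightarrow> nat) \<Rightarrow> (nat \<Rightarrow> nat) set" where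
  "strips y m = {k. k 0 = 0 \<and>
     (\<forall>i\<ge>1. m (Suc i) \<le> k i \<and> k i \<le> m i \<and> (k i = m i \<or> m i \<le> y))}"

text \<open>Chains of partitions from \<open>m\<close> down to the empty one, with one strip per
  limit; the head of the list limits the outermost strip.\<close>

fun strip_chains :: "nat list \<Rightarrow> (nat \<Rightarrow> nat) \<Rightarrow> nat" where
  "strip_chains [] m = (if m = (\<lambda>_. 0) then 1 else 0)"
| "strip_chains (y # ys) m = (\<Sum>k\<in>strips y m. strip_chains ys k)"

declare strip_chains.simps(2) [simp del]

section \<open>Basic properties of strips\<close>

lemma strips_le:
  assumes "k \<in> strips y m"
  shows "k i \<le> m i"
  using assms by (cases i) (auto simp: strips_def)

lemma finite_strips:
  assumes "partition_fun m"
  shows "finite (strips y m)"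
proof -
  let ?A = "{i. m i \<noteq> 0}"
  have fin: "finite ?A"
    using assms by (simp add: partition_fun_def)
  have "strips y m \<subseteq> {f. \<forall>x. (x \<in> ?A \<longrightarrow> f x \<in> {..Max (m ` ?A)}) \<and> (x \<notin> ?A \<longrightarrow> f x = 0)}"
  proof (intro subsetI CollectI allI conjI impI)
    fix k x assume k: "k \<in> strips y m"
    show "k x \<in> {..Max (m ` ?A)}" if "x \<in> ?A"
      using strips_le[OF k, of x] Max_ge[OF finite_imageI[OF fin] imageI[OF that, of m]]
      unfolding atMost_iff by (rule le_trans)
    show "k x = 0" if "x \<notin> ?A"
      using strips_le[OF k, of x] that by simp
  qed
  then show ?thesis
    by (rule finite_subset) (intro finite_set_of_finite_funs fin, simp)
qed

lemma partition_fun_strips: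
  assumes "partition_fun m" and "k \<in> strips y m"
  shows "partition_fun k"
proof -
  have "m i \<noteq> 0" if "k i \<noteq> 0" for i
    using strips_le[OF assms(2), of i] that by simp
  then have "{i. k i \<noteq> 0} \<subseteq> {i. m i \<noteq> 0}"
    by blast
  then have "finite {i. k i \<noteq> 0}"
    using assms(1) by (simp add: partition_fun_def finite_subset)
  moreover have "k (Suc i) \<le> k i" if "i \<ge> 1" for i
  proof -
    have "m (Suc i) \<le> k i"
      using assms(2) that by (simp add: strips_def)
    then show ?thesis
      using strips_le[OF assms(2), of "Suc i"] by simp
  qed
  moreover have "k 0 = 0"
    using assms(2) by (simp add: strips_def)
  ultimately show ?thesis
    by (simp add: partition_fun_def)
qed

text \<open>In a row longer than \<open>y\<close> the first order forces \<open>k i = m i\<close>; replacing this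
  value by the smallest admissible one makes the strips compatible with the other order.\<close>

lemma strips_exchange:
  assumes "y \<le> x" and k: "k \<in> strips y m" and v: "v \<in> strips x k"
  defines "k' \<equiv> \<lambda>i. if i = 0 \<or> m i \<le> y then k i else max (v i) (m (Suc i))"
  shows "k' \<in> strips x m" and "v \<in> strips y k'"
    and "(\<lambda>i. if i = 0 \<or> m i \<le> y then k' i else m i) = k"
proof -
  have k0: "k 0 = 0" and v0: "v 0 = 0"
    using k v by (auto simp: strips_def)
  have kr: "m (Suc i) \<le> k i" "k i \<le> m i" "k i = m i \<or> m i \<le> y" if "i \<ge> 1" for i
    using k that by (auto simp: strips_def)
  have vr: "k (Suc i) \<le> v i" "v i \<le> k i" "v i = k i \<or> k i \<le> x" if "i \<ge> 1" for i
    using v that by (auto simp: strips_def)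
  \<comment> \<open>In a row longer than \<open>y\<close> one has
    \<open>v i \<le> k i = m i\<close>, and either \<open>v i = m i\<close> or
    \<open>m i \<le> x\<close>.\<close>
  have "m (Suc i) \<le> k' i \<and> k' i \<le> m i \<and> (k' i = m i \<or> m i \<le> x)" if "i \<ge> 1" for i
    using kr[OF that] vr[OF that] \<open>y \<le> x\<close> that unfolding k'_def by (auto simp: max_def)
  then show "k' \<in> strips x m"
    using k0 by (simp add: strips_def k'_def)
  \<comment> \<open>The critical case is a row longer than \<open>y\<close> with
    \<open>v i < m (Suc i)\<close>. There \<open>m (Suc i) \<le> y\<close>, since otherwise row
    \<open>Suc i\<close> would be untouched by the first strip, giving
    \<open>m (Suc i) = k (Suc i) \<le> v i\<close>.\<close>
  have "k' (Suc i) \<le> v i \<and> v i \<le> k' i \<and> (v i = k' i \<or> k' i \<le> y)" if "i \<ge> 1" for i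
    using kr[OF that] vr[OF that] kr[of "Suc i"] vr[of "Suc i"] \<open>y \<le> x\<close> that
    unfolding k'_def by (auto simp: max_def)
  then show "v \<in> strips y k'"
    using v0 by (simp add: strips_def)
  show "(\<lambda>i. if i = 0 \<or> m i \<le> y then k' i else m i) = k"
  proof
    fix i
    show "(if i = 0 \<or> m i \<le> y then k' i else m i) = k i"
      using kr[of i] by (cases i) (auto simp: k'_def)
  qed
qed

text \<open>Both sides are sums over pairs \<open>(k, v)\<close>, weighted by the chains below
  \<open>v\<close>. The exchange keeps \<open>v\<close>, hence the weight, and is injective because
  \<open>k\<close> can be recovered from \<open>k'\<close> and \<open>m\<close>.\<close>

lemma strip_chains_swap:
  assumes m: "partition_fun m" and "y \<le> x"
  shows "strip_chains (y # x # ys) m \<le> strip_chains (x # y # ys) m"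
proof -
  have fin: "finite (Sigma (strips a m) (strips b))" for a b
    using finite_strips[OF m] finite_strips[OF partition_fun_strips[OF m]] by blast
  have eq: "strip_chains (a # b # ys) m = (\<Sum>(k, v)\<in>Sigma (strips a m) (strips b). strip_chains ys v)" for a b
    using finite_strips[OF m] finite_strips[OF partition_fun_strips[OF m]]
    by (simp add: sum.Sigma strip_chains.simps(2))
  \<comment> \<open>The decoding map of the exchange: it sends pairs of the larger sum back to pairs
    of the smaller one, as \<open>sum_le_included\<close> requires.\<close>
  let ?dec = "\<lambda>(k, v). (\<lambda>i. if i = 0 \<or> m i \<le> y then k i else m i :: nat, v :: nat \<Rightarrow> nat)"
  have "\<exists>q\<in>Sigma (strips x m) (strips y). ?dec q = p \<and>
      (case p of (k, v) \<Rightarrow> strip_chains ys v) \<le> (case q of (k, v) \<Rightarrow> strip_chains ys v)"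
    if p: "p \<in> Sigma (strips y m) (strips x)" for p
  proof -
    obtain k v where kv: "p = (k, v)" "k \<in> strips y m" "v \<in> strips x k"
      using p by auto
    let ?k' = "\<lambda>i. if i = 0 \<or> m i \<le> y then k i else max (v i) (m (Suc i))"
    have "(?k', v) \<in> Sigma (strips x m) (strips y)"
      using strips_exchange(1,2)[OF \<open>y \<le> x\<close> kv(2,3)] by blast
    moreover have "?dec (?k', v) = p"
      unfolding kv(1) prod.case strips_exchange(3)[OF \<open>y \<le> x\<close> kv(2,3)] by (rule refl)
    ultimately show ?thesis
      unfolding kv(1) by (intro bexI[of _ "(?k', v)"] conjI) (simp_all only: prod.case order_refl)
  qed
  then show ?thesis
    unfolding eq by (intro sum_le_included[OF fin fin, where i = ?dec] ballI) (rule zero_le)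
qed

lemma strip_chains_Cons_mono:
  assumes "partition_fun m" and "\<And>k. partition_fun k \<Longrightarrow> strip_chains xs k \<le> strip_chains ys k"
  shows "strip_chains (x # xs) m \<le> strip_chains (x # ys) m"
  using assms(2)[OF partition_fun_strips[OF assms(1)]]
  by (simp add: sum_mono strip_chains.simps(2))

text \<open>The limit \<open>x\<close> passes the smaller limits one at a time on its way
  outwards.\<close>

lemma strip_chains_move_front:
  assumes "partition_fun m" and "\<And>z. z \<in> set zs \<Longrightarrow> z \<le> x"
  shows "strip_chains (zs @ [x]) m \<le> strip_chains (x # zs) m"
  using assms
proof (induction zs arbitrary: m)
  case (Cons z zs)
  have "strip_chains (z # zs @ [x]) m \<le> strip_chains (z # x # zs) m"
    by (rule strip_chains_Cons_mono[OF Cons.prems(1) Cons.IH]) (auto intro: Cons.prems(2))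
  also have "\<dots> \<le> strip_chains (x # z # zs) m"
    by (rule strip_chains_swap[OF Cons.prems(1) Cons.prems(2)]) simp
  finally show ?case
    by (simp only: append_Cons rev.simps)
qed simp

text \<open>Insertion sort: the largest limit, last in the reversed list, moves to the front, and
  the induction hypothesis sorts the rest.\<close>

lemma strip_chains_rev_le:
  assumes "partition_fun m" and "sorted_wrt (\<ge>) xs"
  shows "strip_chains (rev xs) m \<le> strip_chains xs m"
  using assms
proof (induction xs arbitrary: m)
  case (Cons x xs)
  have "strip_chains (rev xs @ [x]) m \<le> strip_chains (x # rev xs) m"
    by (rule strip_chains_move_front[OF Cons.prems(1)]) (use Cons.prems(2) in simp)
  also have "\<dots> \<le> strip_chains (x # xs) m"
    by (rule strip_chains_Cons_mono[OF Cons.prems(1) Cons.IH]) (use Cons.prems(2) in simp_all)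
  finally show ?case
    by (simp only: append_Cons rev.simps)
qed simp

section \<open>Tableaux with column limits\<close>

definition shape :: "(nat \<Rightarrow> nat) \<Rightarrow> cell set" where
  "shape m = {(i, j). 1 \<le> i \<and> 1 \<le> j \<and> j \<le> m i}"

text \<open>The shape is a function rather than a list of parts because the recursion on the largest
  entry passes to the partitions in \<open>strips\<close>.\<close>

definition limited_tableaux :: "(nat \<Rightarrow> nat) \<Rightarrow> nat \<Rightarrow> (nat \<Rightarrow> nat) \<Rightarrow> (cell \<Rightarrow> nat) set" where
  "limited_tableaux m d b = {T \<in> shape m \<rightarrow>\<^sub>E {1..d}.
     (\<forall>i j j'. (i, j) \<in> shape m \<and> (i, j') \<in> shape m \<and> j < j' \<longrightarrow> T (i, j) \<le> T (i, j')) \<and>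
     (\<forall>i i' j. (i, j) \<in> shape m \<and> (i', j) \<in> shape m \<and> i < i' \<longrightarrow> T (i, j) < T (i', j)) \<and>
     (\<forall>(i, j) \<in> shape m. j \<le> b (T (i, j)))}"

lemma partition_fun_antimono:
  assumes "partition_fun m" and "1 \<le> i" and "i \<le> i'"
  shows "m i' \<le> m i"
  using assms(3)
proof (induction i' rule: dec_induct)
  case (step n)
  then have "m (Suc n) \<le> m n"
    using assms(1,2) by (simp add: partition_fun_def)
  then show ?case
    using step.IH by simp
qed simp

lemma finite_shape:
  assumes "partition_fun m"
  shows "finite (shape m)"
proof -
  have "shape m \<subseteq> Sigma {i. m i \<noteq> 0} (\<lambda>i. {1..m i})"
    by (auto simp: shape_def)
  then show ?thesis
    using assms by (auto simp: partition_fun_def intro: finite_subset)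
qed

lemma finite_limited_tableaux:
  assumes "partition_fun m"
  shows "finite (limited_tableaux m d b)"
  using finite_PiE[OF finite_shape[OF assms], of "\<lambda>_. {1..d}"]
  by (auto simp: limited_tableaux_def intro: finite_subset)

section \<open>Removing and restoring the largest entry\<close>

definition small_part :: "nat \<Rightarrow> (nat \<Rightarrow> nat) \<Rightarrow> (cell \<Rightarrow> nat) \<Rightarrow> nat \<Rightarrow> nat" where
  "small_part d m T i = (if i = 0 then 0 else card {j \<in> {1..m i}. T (i, j) \<le> d})"

text \<open>Rows increase weakly, so the entries at most \<open>d\<close> fill a prefix of each row,
  whose length is the value of \<open>small_part\<close>.\<close>

lemma small_part_iff:
  assumes "T \<in> limited_tableaux m d' b" and "(i, j) \<in> shape m"
  shows "j \<le> small_part d m T i \<longleftrightarrow> T (i, j) \<le> d"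
proof -
  let ?J = "{j \<in> {1..m i}. T (i, j) \<le> d}"
  have row: "T (i, j) \<le> T (i, j')" if "(i, j) \<in> shape m" "(i, j') \<in> shape m" "j \<le> j'" for j j'
    using assms(1) that by (cases "j = j'") (auto simp: limited_tableaux_def)
  have "j \<in> ?J \<longleftrightarrow> 1 \<le> j \<and> j \<le> card ?J"
  proof (rule mem_downset_iff_le_card)
    fix j j' assume "j \<in> ?J" "1 \<le> j'" "j' \<le> j"
    then show "j' \<in> ?J"
      using row[of j' j] assms(2) by (auto simp: shape_def)
  qed auto
  moreover have "j \<in> ?J \<longleftrightarrow> T (i, j) \<le> d" "1 \<le> j" "i \<noteq> 0"
    using assms(2) by (auto simp: shape_def)
  ultimately show ?thesis
    by (simp add: small_part_def)
qed

lemma shape_mono: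
  assumes "\<And>i. k i \<le> m i"
  shows "shape k \<subseteq> shape m"
  using assms by (auto simp: shape_def intro: le_trans)

text \<open>Strict columns put at most one entry \<open>Suc d\<close> in each column, so these
  entries form a horizontal strip. If a row contains one, its last cell does, and the limit
  \<open>b (Suc d)\<close> bounds the whole row.\<close>

lemma limited_tableaux_remove_largest:
  assumes m: "partition_fun m" and T: "T \<in> limited_tableaux m (Suc d) b"
  defines "k \<equiv> small_part d m T"
  shows "k \<in> strips (b (Suc d)) m" and "restrict T (shape k) \<in> limited_tableaux k d b"
proof -
  have iff: "j \<le> k i \<longleftrightarrow> T (i, j) \<le> d" if "(i, j) \<in> shape m" for i j
    unfolding k_def by (rule small_part_iff[OF T that])
  have rng: "1 \<le> T (i, j)" "T (i, j) \<le> Suc d" "j \<le> b (T (i, j))" if "(i, j) \<in> shape m" for i j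
    using T that by (auto simp: limited_tableaux_def)
  have le: "k i \<le> m i" for i
    using card_mono[OF _ Collect_restrict, of "{1..m i}" "\<lambda>j. T (i, j) \<le> d"] by (simp add: k_def small_part_def)
  have "m (Suc i) \<le> k i \<and> k i \<le> m i \<and> (k i = m i \<or> m i \<le> b (Suc d))" if "i \<ge> 1" for i
  proof (intro conjI)
    show "m (Suc i) \<le> k i"
    proof (cases "m (Suc i) = 0")
      case False
      let ?j = "m (Suc i)"
      have "?j \<le> m i"
        using m that by (auto simp: partition_fun_def)
      then have in_shape: "(i, ?j) \<in> shape m" "(Suc i, ?j) \<in> shape m"
        using False that by (auto simp: shape_def)
      then have "T (i, ?j) < T (Suc i, ?j)"
        using T by (auto simp: limited_tableaux_def)
      then show ?thesis
        using iff in_shape rng(2) by fastforce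
    qed simp
    show "k i = m i \<or> m i \<le> b (Suc d)"
    proof (cases "k i = m i")
      case False
      then have "(i, m i) \<in> shape m" "k i < m i"
        using le[of i] that by (auto simp: shape_def)
      then show ?thesis
        using iff rng[of i "m i"] by (metis le_antisym not_le not_less_eq_eq)
    qed simp
  qed (rule le)
  then show "k \<in> strips (b (Suc d)) m"
    by (auto simp: strips_def k_def small_part_def)
  have sub: "shape k \<subseteq> shape m"
    by (intro shape_mono le)
  have kd: "T (i, j) \<le> d" if "(i, j) \<in> shape k" for i j
    using iff[of i j] that sub by (auto simp: shape_def)
  show "restrict T (shape k) \<in> limited_tableaux k d b"
    using T sub kd rng unfolding limited_tableaux_def by (auto simp: subset_iff)
qed

text \<open>The inverse construction: \<open>Suc d\<close> is written into all cells of the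
  strip.\<close>

lemma limited_tableaux_add_largest:
  assumes m: "partition_fun m" and k: "k \<in> strips (b (Suc d)) m" and U: "U \<in> limited_tableaux k d b"
  defines "T \<equiv> \<lambda>(i, j)\<in>shape m. if j \<le> k i then U (i, j) else Suc d"
  shows "T \<in> limited_tableaux m (Suc d) b" and "small_part d m T = k"
    and "restrict T (shape k) = U"
proof -
  have le: "k i \<le> m i" for i
    by (rule strips_le[OF k])
  have sub: "shape k \<subseteq> shape m"
    by (intro shape_mono le)
  have in_k: "(i, j) \<in> shape k" if "(i, j) \<in> shape m" "j \<le> k i" for i j
    using that by (auto simp: shape_def)
  have T1: "T (i, j) = U (i, j)" if "(i, j) \<in> shape k" for i j
    using that sub by (auto simp: T_def shape_def)
  have T2: "T (i, j) = Suc d" if "(i, j) \<in> shape m" "\<not> j \<le> k i" for i j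
    using that by (auto simp: T_def)
  have Ur: "1 \<le> U (i, j)" "U (i, j) \<le> d" "j \<le> b (U (i, j))" if "(i, j) \<in> shape k" for i j
    using U that by (auto simp: limited_tableaux_def)
  have Trow: "T (i, j) \<le> T (i, j')" if "(i, j) \<in> shape m" "(i, j') \<in> shape m" "j < j'" for i j j'
  proof (cases "j' \<le> k i")
    case True
    then have "(i, j) \<in> shape k" "(i, j') \<in> shape k"
      using in_k that by auto
    then show ?thesis
      using U that by (auto simp: T1 limited_tableaux_def)
  next
    case False
    then show ?thesis
      using T1[OF in_k] T2 Ur(2)[OF in_k] that by (metis le_SucI order_refl)
  qed
  have Tcol: "T (i, j) < T (i', j)" if s: "(i, j) \<in> shape m" "(i', j) \<in> shape m" "i < i'" for i i' j
  proof -
    \<comment> \<open>By interlacing, a cell with another cell of the shape below it lies in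
      \<open>k\<close>, so its entry is at most \<open>d\<close>. This settles the case where the
      lower entry is \<open>Suc d\<close>.\<close>
    have "j \<le> m (Suc i)"
      using s partition_fun_antimono[OF m, of "Suc i" i'] by (auto simp: shape_def)
    moreover have "m (Suc i) \<le> k i"
      using k s by (auto simp: strips_def shape_def)
    ultimately have ij: "(i, j) \<in> shape k"
      using in_k s by auto
    show ?thesis
    proof (cases "j \<le> k i'")
      case True
      then show ?thesis
        using U ij in_k[OF s(2)] s(3) by (auto simp: T1 limited_tableaux_def)
    next
      case False
      then show ?thesis
        using T1[OF ij] T2[OF s(2)] Ur(2)[OF ij] by simp
    qed
  qed
  have Trng: "1 \<le> T (i, j) \<and> T (i, j) \<le> Suc d \<and> j \<le> b (T (i, j))" if s: "(i, j) \<in> shape m" for i j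
  proof (cases "j \<le> k i")
    case True
    then show ?thesis
      using T1[OF in_k] Ur[OF in_k] s by fastforce
  next
    case False
    moreover have "k i = m i \<or> m i \<le> b (Suc d)" "j \<le> m i"
      using k s by (auto simp: strips_def shape_def)
    ultimately show ?thesis
      using T2[OF s] by auto
  qed
  have "T \<in> shape m \<rightarrow>\<^sub>E {1..Suc d}"
  proof -
    have "T \<in> extensional (shape m)"
      unfolding T_def by (rule restrict_extensional)
    then show ?thesis
      using Trng by (auto simp: PiE_iff)
  qed
  then show "T \<in> limited_tableaux m (Suc d) b"
    using Trow Tcol Trng unfolding limited_tableaux_def by blast
  show "restrict T (shape k) = U"
    using U T1 by (auto simp: limited_tableaux_def PiE_iff intro!: extensionalityI[where A = "shape k"])
  show "small_part d m T = k"
  proof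
    fix i
    show "small_part d m T i = k i"
    proof (cases "i = 0")
      case True
      then show ?thesis
        using k by (simp add: small_part_def strips_def)
    next
      case False
      have "T (i, j) \<le> d \<longleftrightarrow> j \<le> k i" if "j \<in> {1..m i}" for j
      proof -
        have "(i, j) \<in> shape m"
          using that False by (auto simp: shape_def)
        then show ?thesis
          using T1[OF in_k, of i j] T2[of i j] Ur(2)[OF in_k, of i j] by (cases "j \<le> k i") auto
      qed
      then have "{j \<in> {1..m i}. T (i, j) \<le> d} = {1..k i}"
        using le[of i] by auto
      then show ?thesis
        using False by (simp add: small_part_def)
    qed
  qed
qed

text \<open>Recursion on the largest entry: the cells holding \<open>d\<close> form the outermost
  strip, so \<open>b d\<close> must head the list, whence the \<open>rev\<close>.\<close>

lemma card_limited_tableaux: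
  assumes "partition_fun m"
  shows "card (limited_tableaux m d b) = strip_chains (rev (map b [1..<Suc d])) m"
  using assms
proof (induction d arbitrary: m)
  case 0
  show ?case
  proof (cases "m = (\<lambda>_. 0)")
    case True
    then have "shape m = {}"
      by (auto simp: shape_def)
    then show ?thesis
      using True by (simp add: limited_tableaux_def)
  next
    case False
    \<comment> \<open>As \<open>m 0 = 0\<close>, a nonzero \<open>m\<close> has a cell in a row
      \<open>i \<ge> 1\<close>, and no entry from \<open>{1..0}\<close> can fill it.\<close>
    then obtain i where "m i \<noteq> 0"
      by auto
    moreover from this have "i \<noteq> 0"
      using 0 by (metis partition_fun_def)
    ultimately have "(i, 1) \<in> shape m"
      by (auto simp: shape_def)
    then have "limited_tableaux m 0 b = {}"
      by (auto simp: limited_tableaux_def)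
    then show ?thesis
      using False by simp
  qed
next
  case (Suc d)
  let ?S = "Sigma (strips (b (Suc d)) m) (\<lambda>k. limited_tableaux k d b)"
  have "bij_betw (\<lambda>T. (small_part d m T, restrict T (shape (small_part d m T))))
      (limited_tableaux m (Suc d) b) ?S"
  proof (rule bij_betw_byWitness
      [where f' = "\<lambda>(k, U). \<lambda>(i, j)\<in>shape m. if j \<le> k i then U (i, j) else Suc d"])
    show "\<forall>T\<in>limited_tableaux m (Suc d) b.
      (case (small_part d m T, restrict T (shape (small_part d m T))) of
        (k, U) \<Rightarrow> \<lambda>(i, j)\<in>shape m. if j \<le> k i then U (i, j) else Suc d) = T"
    proof
      fix T assume T: "T \<in> limited_tableaux m (Suc d) b"
      have "(if j \<le> small_part d m T i then restrict T (shape (small_part d m T)) (i, j) else Suc d) = T (i, j)"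
        if "(i, j) \<in> shape m" for i j
      proof (cases "j \<le> small_part d m T i")
        case True
        then have "(i, j) \<in> shape (small_part d m T)"
          using that by (auto simp: shape_def)
        then show ?thesis
          using True by simp
      next
        case False
        moreover have "T (i, j) \<le> Suc d"
          using T that by (auto simp: limited_tableaux_def)
        ultimately show ?thesis
          using small_part_iff[OF T that, of d] by simp
      qed
      then show "(case (small_part d m T, restrict T (shape (small_part d m T))) of
        (k, U) \<Rightarrow> \<lambda>(i, j)\<in>shape m. if j \<le> k i then U (i, j) else Suc d) = T"
        using T by (auto simp: limited_tableaux_def PiE_iff intro!: extensionalityI[where A = "shape m"])
    qed
  qed (use limited_tableaux_remove_largest[OF Suc.prems] limited_tableaux_add_largest[OF Suc.prems] in auto)
  then have "card (limited_tableaux m (Suc d) b) = card ?S"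
    by (rule bij_betw_same_card)
  also have "\<dots> = (\<Sum>k\<in>strips (b (Suc d)) m. card (limited_tableaux k d b))"
    using finite_strips[OF Suc.prems] finite_limited_tableaux[OF partition_fun_strips[OF Suc.prems]]
    by (simp add: card_SigmaI)
  also have "\<dots> = (\<Sum>k\<in>strips (b (Suc d)) m. strip_chains (rev (map b [1..<Suc d])) k)"
    using Suc.IH[OF partition_fun_strips[OF Suc.prems]] by (simp only: cong: sum.cong)
  finally show ?case
    by (simp add: strip_chains.simps(2))
qed

text \<open>With \<open>xs = map b [1..<Suc d]\<close>, which is weakly decreasing, the two sides
  count the chains for \<open>rev xs\<close> and for \<open>xs\<close>.\<close>

lemma card_limited_tableaux_le_reversed:
  assumes "partition_fun m" and "\<And>s t. 1 \<le> s \<Longrightarrow> s \<le> t \<Longrightarrow> b t \<le> b s"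
  shows "card (limited_tableaux m d b) \<le> card (limited_tableaux m d (\<lambda>t. b (Suc d - t)))"
proof -
  have "rev (map (\<lambda>t. b (Suc d - t)) [1..<Suc d]) = map b [1..<Suc d]"
    by (rule nth_equalityI) (auto simp: rev_nth simp del: upt_Suc)
  moreover have "sorted_wrt (\<ge>) (map b [1..<Suc d])"
    using assms(2) by (auto simp: sorted_wrt_iff_nth_less simp del: upt_Suc)
  ultimately show ?thesis
    using assms(1) by (simp only: card_limited_tableaux strip_chains_rev_le)
qed

section \<open>Excited diagrams as flagged tableaux\<close>

lemma part_antimono:
  assumes "is_partition p" and "1 \<le> i" and "i \<le> i'"
  shows "part p i' \<le> part p i"
proof (cases "i = i' \<or> length p < i'")
  case True
  then show ?thesis
    by (auto simp: part_def)
next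
  case False
  then show ?thesis
    using assms sorted_wrt_nth_less[of "(\<ge>)" p "i - 1" "i' - 1"]
    by (auto simp: part_def is_partition_def)
qed

lemma diagram_iff: "(i, j) \<in> diagram p \<longleftrightarrow> 1 \<le> i \<and> 1 \<le> j \<and> j \<le> part p i"
  by (auto simp: diagram_def part_def)

lemma diagram_eq_shape: "diagram p = shape (part p)"
  by (auto simp: diagram_iff shape_def)

lemma partition_fun_part:
  assumes "is_partition p"
  shows "partition_fun (part p)"
proof -
  have "{i. part p i \<noteq> 0} \<subseteq> {..length p}"
    by (auto simp: part_def)
  then show ?thesis
    using assms by (auto simp: partition_fun_def part_antimono finite_subset part_def[of p 0])
qed

lemma finite_diagram:
  assumes "is_partition p"
  shows "finite (diagram p)"
  using finite_shape[OF partition_fun_part[OF assms]] by (simp add: diagram_eq_shape)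

lemma diagram_down:
  assumes "is_partition p" and "(i', j') \<in> diagram p" and "1 \<le> i" "i \<le> i'" and "1 \<le> j" "j \<le> j'"
  shows "(i, j) \<in> diagram p"
  using assms part_antimono[of p i i'] by (simp add: diagram_iff)

text \<open>Walk down column \<open>j\<close>, gaining at least 1 per row, then right along row
  \<open>i'\<close>. In particular entries strictly increase along diagonals.\<close>

lemma semistandard_add_le:
  assumes mu: "is_partition mu" and T: "semistandard mu T"
    and "(i, j) \<in> diagram mu" and "(i', j') \<in> diagram mu" and "i \<le> i'" and "j \<le> j'"
  shows "T (i, j) + (i' - i) \<le> T (i', j')"
proof -
  have pos: "1 \<le> i" "1 \<le> j"
    using assms(3) by (simp_all add: diagram_iff)
  have "T (i, j) + (n - i) \<le> T (n, j)" if "i \<le> n" "n \<le> i'" for n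
    using that
  proof (induction n rule: dec_induct)
    case (step n)
    have "(n, j) \<in> diagram mu" "(Suc n, j) \<in> diagram mu"
      using diagram_down[OF mu assms(4)] step pos assms(6) by simp_all
    then have "T (n, j) < T (Suc n, j)"
      using T by (simp add: semistandard_def)
    then show ?case
      using step by simp
  qed simp
  from this[of i'] have "T (i, j) + (i' - i) \<le> T (i', j)"
    using assms(5) by simp
  moreover have "T (i', j) \<le> T (i', j')"
  proof (cases "j = j'")
    case False
    moreover have "(i', j) \<in> diagram mu"
      using diagram_down[OF mu assms(4)] pos assms(5,6) by simp
    ultimately show ?thesis
      using T assms(4,6) by (simp add: semistandard_def)
  qed simp
  ultimately show ?thesis
    by simp
qed

lemma semistandard_fun_upd:
  assumes "semistandard mu T"
    and "\<And>j'. j < j' \<Longrightarrow> (i, j') \<in> diagram mu \<Longrightarrow> n \<le> T (i, j')"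
    and "\<And>j'. j' < j \<Longrightarrow> (i, j') \<in> diagram mu \<Longrightarrow> T (i, j') \<le> n"
    and "\<And>i'. i < i' \<Longrightarrow> (i', j) \<in> diagram mu \<Longrightarrow> n < T (i', j)"
    and "\<And>i'. i' < i \<Longrightarrow> (i', j) \<in> diagram mu \<Longrightarrow> T (i', j) < n"
  shows "semistandard mu (T((i, j) := n))"
  using assms by (simp add: semistandard_def)

text \<open>The target cell is the one in row \<open>T (i, j)\<close> on the diagonal of
  \<open>(i, j)\<close>. Truncation of the subtraction does no harm, since
  \<open>i \<le> T (i, j)\<close> will follow.\<close>

definition flagged_tableaux :: "nat list \<Rightarrow> nat list \<Rightarrow> (cell \<Rightarrow> nat) set" where
  "flagged_tableaux lam mu = {T \<in> extensional (diagram mu). semistandard mu T \<and>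
     (\<forall>(i, j) \<in> diagram mu. (T (i, j), T (i, j) + j - i) \<in> diagram lam)}"

text \<open>The cell \<open>(i, j)\<close> of \<open>mu\<close> has been moved down its diagonal to row \<open>T (i, j) \<ge> i\<close>.\<close>

definition tableau_cells :: "nat list \<Rightarrow> (cell \<Rightarrow> nat) \<Rightarrow> cell set" where
  "tableau_cells mu T = (\<lambda>(i, j). (T (i, j), T (i, j) + j - i)) ` diagram mu"

lemma flagged_tableauxD:
  assumes "is_partition mu" and "T \<in> flagged_tableaux lam mu"
  shows "semistandard mu T" and "T \<in> extensional (diagram mu)"
    and "(i, j) \<in> diagram mu \<Longrightarrow> (T (i, j), T (i, j) + j - i) \<in> diagram lam"
    and "(i, j) \<in> diagram mu \<Longrightarrow> i \<le> T (i, j)"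
proof -
  show T: "semistandard mu T" "T \<in> extensional (diagram mu)"
    and lam: "(i, j) \<in> diagram mu \<Longrightarrow> (T (i, j), T (i, j) + j - i) \<in> diagram lam" for i j
    using assms(2) by (auto simp: flagged_tableaux_def)
  show "i \<le> T (i, j)" if "(i, j) \<in> diagram mu"
  proof -
    have "(1, j) \<in> diagram mu" "1 \<le> i"
      using diagram_down[OF assms(1) that, of 1 j] that by (simp_all add: diagram_iff)
    then show ?thesis
      using semistandard_add_le[OF assms(1) T(1) _ that, of 1 j] lam[of 1 j] by (auto simp: diagram_iff)
  qed
qed

text \<open>The diagonal is expressed by an equation between sums to avoid truncated
  subtraction.\<close>

lemma tableau_cells_iff:
  assumes "is_partition mu" and "T \<in> flagged_tableaux lam mu"
  shows "(a, b) \<in> tableau_cells mu T \<longleftrightarrow> (\<exists>i j. (i, j) \<in> diagram mu \<and> T (i, j) = a \<and> a + j = b + i)"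
proof -
  have "(a, b) = (T (i, j), T (i, j) + j - i) \<longleftrightarrow> T (i, j) = a \<and> a + j = b + i"
    if "(i, j) \<in> diagram mu" for i j
    using flagged_tableauxD(4)[OF assms that] by auto
  then show ?thesis
    unfolding tableau_cells_def image_iff by (auto simp: Bex_def)
qed

text \<open>Cells stay on their diagonals and keep their order there, so the occupied rows of each
  diagonal determine the tableau. Formally, rows are compared by induction from the top.\<close>

lemma inj_on_tableau_cells:
  assumes mu: "is_partition mu"
  shows "inj_on (tableau_cells mu) (flagged_tableaux lam mu)"
proof (rule inj_onI)
  fix T U assume T: "T \<in> flagged_tableaux lam mu" and U: "U \<in> flagged_tableaux lam mu"
    and eq: "tableau_cells mu T = tableau_cells mu U"
  have le: "U (i, j) \<le> T (i, j)"
    if T: "T \<in> flagged_tableaux lam mu" and U: "U \<in> flagged_tableaux lam mu"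
      and eq: "tableau_cells mu T = tableau_cells mu U" and ij: "(i, j) \<in> diagram mu"
      and IH: "\<And>i' j'. i' < i \<Longrightarrow> (i', j') \<in> diagram mu \<Longrightarrow> T (i', j') = U (i', j')" for T U i j
  proof -
    have "(T (i, j), T (i, j) + j - i) \<in> tableau_cells mu T"
      using ij by (force simp: tableau_cells_def)
    then obtain i' j' where i': "(i', j') \<in> diagram mu" "U (i', j') = T (i, j)"
      "T (i, j) + j' = T (i, j) + j - i + i'"
      unfolding eq tableau_cells_iff[OF mu U] by auto
    have diag: "j' + i = j + i'"
      using i'(3) flagged_tableauxD(4)[OF mu T ij] by simp
    \<comment> \<open>The cell reached by \<open>(i, j)\<close> under \<open>T\<close> is reached by
      \<open>(i', j')\<close> under \<open>U\<close>. If \<open>i' < i\<close>, the two tableaux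
      agree at \<open>(i', j')\<close>, and \<open>T\<close> would repeat an entry on a
      diagonal.\<close>
    show ?thesis
    proof (cases "i \<le> i'")
      case True
      then show ?thesis
        using semistandard_add_le[OF mu flagged_tableauxD(1)[OF mu U] ij i'(1)] diag i'(2) by simp
    next
      case False
      then show ?thesis
        using semistandard_add_le[OF mu flagged_tableauxD(1)[OF mu T] i'(1) ij] diag i'(2) IH[of i' j'] i'(1)
        by simp
    qed
  qed
  have "\<forall>j. (i, j) \<in> diagram mu \<longrightarrow> T (i, j) = U (i, j)" for i
  proof (induction i rule: less_induct)
    case (less i)
    then show ?case
      using le[OF T U eq] le[OF U T eq[symmetric]] by (metis le_antisym)
  qed
  then show "T = U"
    using flagged_tableauxD(2)[OF mu T] flagged_tableauxD(2)[OF mu U]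
    by (intro extensionalityI[where A = "diagram mu"]) auto
qed

text \<open>Distinct cells of \<open>mu\<close> have distinct targets, as entries strictly increase
  along diagonals; hence changing one entry relocates exactly one target.\<close>

lemma tableau_cells_fun_upd:
  assumes mu: "is_partition mu" and T: "T \<in> flagged_tableaux lam mu" and ij: "(i, j) \<in> diagram mu"
  shows "tableau_cells mu (T((i, j) := n)) =
    insert (n, n + j - i) (tableau_cells mu T - {(T (i, j), T (i, j) + j - i)})"
proof -
  let ?c = "\<lambda>(i, j). (T (i, j), T (i, j) + j - i)"
  have "?c (i', j') \<noteq> ?c (i, j)" if "(i', j') \<in> diagram mu" "(i', j') \<noteq> (i, j)" for i' j'
  proof
    assume "?c (i', j') = ?c (i, j)"
    then have eq: "T (i', j') = T (i, j)" and "j' + i = j + i'"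
      using flagged_tableauxD(4)[OF mu T that(1)] flagged_tableauxD(4)[OF mu T ij] by auto
    then show False
      using semistandard_add_le[OF mu flagged_tableauxD(1)[OF mu T] that(1) ij]
        semistandard_add_le[OF mu flagged_tableauxD(1)[OF mu T] ij that(1)] that(2)
      by (cases "i' \<le> i") auto
  qed
  then have "tableau_cells mu T - {?c (i, j)} = ?c ` (diagram mu - {(i, j)})"
    using ij unfolding tableau_cells_def by (auto simp del: prod.inject)
  moreover have "tableau_cells mu (T((i, j) := n)) = insert (n, n + j - i) (?c ` (diagram mu - {(i, j)}))"
  proof -
    have "diagram mu = insert (i, j) (diagram mu - {(i, j)})"
      using ij by auto
    then have "tableau_cells mu (T((i, j) := n)) =
      (\<lambda>(i', j'). ((T((i, j) := n)) (i', j'), (T((i, j) := n)) (i', j') + j' - i')) ` insert (i, j) (diagram mu - {(i, j)})"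
      by (simp add: tableau_cells_def)
    also have "\<dots> = insert (n, n + j - i) (?c ` (diagram mu - {(i, j)}))"
      unfolding image_insert by (intro arg_cong2[where f = insert] image_cong) (auto split: if_splits)
    finally show ?thesis .
  qed
  ultimately show ?thesis
    by simp
qed

text \<open>An excited move raises one entry from \<open>a\<close> to \<open>a + 1\<close>. The free
  cell to the right excludes \<open>T (i, j + 1) = a\<close>, and the free cell below excludes
  \<open>T (i + 1, j) = a + 1\<close>.\<close>

lemma flagged_tableaux_move:
  assumes mu: "is_partition mu" and T: "T \<in> flagged_tableaux lam mu"
    and act: "active lam (tableau_cells mu T) a b"
  shows "\<exists>U\<in>flagged_tableaux lam mu.
    tableau_cells mu U = insert (a + 1, b + 1) (tableau_cells mu T - {(a, b)})"
proof -
  note iff = tableau_cells_iff[OF mu T]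
  have "(a, b) \<in> tableau_cells mu T"
    using act by (simp add: active_def)
  then obtain i j where ij: "(i, j) \<in> diagram mu" "T (i, j) = a" "a + j = b + i"
    using iff by auto
  have notin: "(a + 1, b) \<notin> tableau_cells mu T" "(a, b + 1) \<notin> tableau_cells mu T"
    and lam: "(a + 1, b + 1) \<in> diagram lam"
    using act by (auto simp: active_def)
  have "i \<le> a"
    using flagged_tableauxD(4)[OF mu T ij(1)] ij(2) by simp
  have pos: "1 \<le> i" "1 \<le> j"
    using ij(1) by (simp_all add: diagram_iff)
  note ss = flagged_tableauxD(1)[OF mu T]
  let ?U = "T((i, j) := a + 1)"
  have "semistandard mu ?U"
  proof (rule semistandard_fun_upd[OF ss])
    fix j' assume j': "j < j'" "(i, j') \<in> diagram mu"
    then have next_col: "(i, j + 1) \<in> diagram mu"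
      using diagram_down[OF mu j'(2)] pos by simp
    have "T (i, j + 1) \<noteq> a"
    proof
      assume "T (i, j + 1) = a"
      then have "(a, b + 1) \<in> tableau_cells mu T"
        unfolding iff using next_col ij(3) by (intro exI[of _ i] exI[of _ "j + 1"]) simp
      then show False
        using notin(2) by contradiction
    qed
    then show "a + 1 \<le> T (i, j')"
      using semistandard_add_le[OF mu ss ij(1) next_col] semistandard_add_le[OF mu ss next_col j'(2)] j'(1) ij(2)
      by simp
  next
    fix j' assume "j' < j" "(i, j') \<in> diagram mu"
    then show "T (i, j') \<le> a + 1"
      using semistandard_add_le[OF mu ss _ ij(1), of i j'] ij(2) by simp
  next
    fix i' assume i': "i < i'" "(i', j) \<in> diagram mu"
    then have next_row: "(i + 1, j) \<in> diagram mu"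
      using diagram_down[OF mu i'(2)] pos by simp
    have "T (i + 1, j) \<noteq> a + 1"
    proof
      assume "T (i + 1, j) = a + 1"
      then have "(a + 1, b) \<in> tableau_cells mu T"
        unfolding iff using next_row ij(3) by (intro exI[of _ "i + 1"] exI[of _ j]) simp
      then show False
        using notin(1) by contradiction
    qed
    then show "a + 1 < T (i', j)"
      using semistandard_add_le[OF mu ss ij(1) next_row] semistandard_add_le[OF mu ss next_row i'(2)] i'(1) ij(2)
      by simp
  next
    fix i' assume "i' < i" "(i', j) \<in> diagram mu"
    then show "T (i', j) < a + 1"
      using semistandard_add_le[OF mu ss _ ij(1), of i' j] ij(2) by simp
  qed
  moreover have "?U \<in> extensional (diagram mu)"
    using flagged_tableauxD(2)[OF mu T] ij(1) by (auto simp: extensional_def)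
  moreover have b: "b = a + j - i"
    using ij(3) by simp
  then have "a + 1 + j - i = b + 1"
    using \<open>i \<le> a\<close> by simp
  moreover from this have "\<forall>(i', j')\<in>diagram mu. (?U (i', j'), ?U (i', j') + j' - i') \<in> diagram lam"
    using flagged_tableauxD(3)[OF mu T] lam by auto
  ultimately have "?U \<in> flagged_tableaux lam mu"
    by (simp add: flagged_tableaux_def)
  moreover have "tableau_cells mu ?U = insert (a + 1, b + 1) (tableau_cells mu T - {(a, b)})"
    using tableau_cells_fun_upd[OF mu T ij(1), of "a + 1"] \<open>a + 1 + j - i = b + 1\<close> b ij(2) by simp
  ultimately show ?thesis
    by blast
qed

lemma excited_diagrams_subset_tableau_cells:
  assumes "skew_shape lam mu"
  shows "excited_diagrams lam mu \<subseteq> tableau_cells mu ` flagged_tableaux lam mu"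
proof
  have mu: "is_partition mu"
    using assms by (simp add: skew_shape_def)
  fix D assume "D \<in> excited_diagrams lam mu"
  then show "D \<in> tableau_cells mu ` flagged_tableaux lam mu"
  proof induction
    case start
    \<comment> \<open>The tableau of row indices, in which no cell has moved.\<close>
    let ?T = "restrict fst (diagram mu) :: cell \<Rightarrow> nat"
    have "?T \<in> flagged_tableaux lam mu"
      using assms by (auto simp: flagged_tableaux_def semistandard_def skew_shape_def)
    moreover have "tableau_cells mu ?T = diagram mu"
      by (force simp: tableau_cells_def)
    ultimately show ?case
      by (metis image_eqI)
  next
    case (move D a b)
    then obtain T where "T \<in> flagged_tableaux lam mu" "D = tableau_cells mu T"
      by blast
    then show ?case
      using flagged_tableaux_move[OF mu, of T lam a b] move.hyps(2) by (metis image_eqI)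
  qed
qed

text \<open>Induction on the sum of the entries: a suitable entry is lowered by 1, and the resulting
  set of cells, excited by induction, leads back by one excited move.\<close>

lemma flagged_tableau_excited:
  assumes lam: "is_partition lam" and mu: "is_partition mu" and "T \<in> flagged_tableaux lam mu"
  shows "tableau_cells mu T \<in> excited_diagrams lam mu"
  using assms(3)
proof (induction "\<Sum>c\<in>diagram mu. T c" arbitrary: T rule: less_induct)
  case less
  note T = less.prems
  note ss = flagged_tableauxD(1)[OF mu T]
  show ?case
  proof (cases "\<forall>(i, j)\<in>diagram mu. T (i, j) = i")
    case True
    then have "tableau_cells mu T = diagram mu"
      by (force simp: tableau_cells_def)
    then show ?thesis
      by (simp add: excited_diagrams.start)
  next
    case False
    then have "\<exists>i j. (i, j) \<in> diagram mu \<and> T (i, j) \<noteq> i"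
      by auto
    \<comment> \<open>Choosing a displaced cell with minimal \<open>i + j\<close> leaves all cells
      to its left and above it in their own rows, so lowering its entry keeps the tableau
      semistandard.\<close>
    then obtain n where "\<exists>i j. (i, j) \<in> diagram mu \<and> T (i, j) \<noteq> i \<and> i + j = n"
      and nmin: "\<And>n'. n' < n \<Longrightarrow> \<not> (\<exists>i j. (i, j) \<in> diagram mu \<and> T (i, j) \<noteq> i \<and> i + j = n')"
      using exists_least_iff[of "\<lambda>n. \<exists>i j. (i, j) \<in> diagram mu \<and> T (i, j) \<noteq> i \<and> i + j = n"] by metis
    then obtain i j where ij: "(i, j) \<in> diagram mu" "T (i, j) \<noteq> i" "i + j = n"
      by blast
    have minimal: "T (i', j') = i'" if "(i', j') \<in> diagram mu" "i' + j' < i + j" for i' j'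
      using nmin[of "i' + j'"] that ij(3) by blast
    define a where "a = T (i, j) - 1"
    define b where "b = a + j - i"
    have Tij: "T (i, j) = a + 1" "i \<le> a"
      using flagged_tableauxD(4)[OF mu T ij(1)] ij(2) by (auto simp: a_def)
    have b: "a + j = b + i" "a + 1 + j - i = b + 1"
      using Tij by (auto simp: b_def)
    have pos: "1 \<le> i" "1 \<le> j"
      using ij(1) by (simp_all add: diagram_iff)
    have end_cell: "(a + 1, b + 1) \<in> diagram lam"
      using flagged_tableauxD(3)[OF mu T ij(1)] Tij b by simp
    have "1 \<le> b" "1 \<le> a"
      using b Tij pos by simp_all
    then have lam_cells: "(a, b) \<in> diagram lam" "(a + 1, b) \<in> diagram lam" "(a, b + 1) \<in> diagram lam"
      using diagram_down[OF lam end_cell] by simp_all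
    let ?U = "T((i, j) := a)"
    have ssU: "semistandard mu ?U"
    proof (rule semistandard_fun_upd[OF ss])
      fix j' assume "j < j'" "(i, j') \<in> diagram mu"
      then show "a \<le> T (i, j')"
        using semistandard_add_le[OF mu ss ij(1), of i j'] Tij by simp
    next
      fix j' assume "j' < j" "(i, j') \<in> diagram mu"
      then show "T (i, j') \<le> a"
        using minimal[of i j'] Tij by simp
    next
      fix i' assume "i < i'" "(i', j) \<in> diagram mu"
      then show "a < T (i', j)"
        using semistandard_add_le[OF mu ss ij(1), of i' j] Tij by simp
    next
      fix i' assume "i' < i" "(i', j) \<in> diagram mu"
      then show "T (i', j) < a"
        using minimal[of i' j] Tij by simp
    qed
    moreover have "?U \<in> extensional (diagram mu)"
      using flagged_tableauxD(2)[OF mu T] ij(1) by (auto simp: extensional_def)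
    moreover have "\<forall>(i', j')\<in>diagram mu. (?U (i', j'), ?U (i', j') + j' - i') \<in> diagram lam"
      using flagged_tableauxD(3)[OF mu T] lam_cells(1) b_def by auto
    ultimately have U: "?U \<in> flagged_tableaux lam mu"
      by (simp add: flagged_tableaux_def)
    have "(\<Sum>c\<in>diagram mu. ?U c) < (\<Sum>c\<in>diagram mu. T c)"
      using ij(1) Tij by (intro sum_strict_mono_ex1 finite_diagram mu) auto
    then have IH: "tableau_cells mu ?U \<in> excited_diagrams lam mu"
      using less.hyps U by blast
    note leU = semistandard_add_le[OF mu ssU]
    have no_right: "(a, b + 1) \<notin> tableau_cells mu ?U"
    proof
      assume "(a, b + 1) \<in> tableau_cells mu ?U"
      then obtain i' j' where i': "(i', j') \<in> diagram mu" "?U (i', j') = a" "a + j' = b + 1 + i'"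
        unfolding tableau_cells_iff[OF mu U] by auto
      have diag: "j' + i = j + 1 + i'"
        using i'(3) b(1) by simp
      \<comment> \<open>A cell of \<open>mu\<close> on the next diagonal is either weakly south-east
        of \<open>(i, j + 1)\<close>, with entry above \<open>a\<close>, or weakly north-west of
        \<open>(i - 1, j)\<close>, with entry below \<open>a\<close>.\<close>
      show False
      proof (cases "i \<le> i'")
        case True
        then have r: "(i, j + 1) \<in> diagram mu"
          using diagram_down[OF mu i'(1)] pos diag by simp
        show False
          using leU[OF r i'(1)] semistandard_add_le[OF mu ss ij(1) r] True diag i'(2) Tij by simp
      next
        case False
        then have r: "(i - 1, j) \<in> diagram mu"
          using diagram_down[OF mu ij(1), of "i - 1" j] pos i'(1) by (auto simp: diagram_iff)
        have "i' \<le> i - 1" "j' \<le> j" "i - 1 \<le> i" "i - (i - 1) = 1" "?U (i, j) = a"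
          using False diag pos by auto
        then show False
          using leU[OF i'(1) r] leU[OF r ij(1)] i'(2) by linarith
      qed
    qed
    have no_below: "(a + 1, b) \<notin> tableau_cells mu ?U"
    proof
      assume "(a + 1, b) \<in> tableau_cells mu ?U"
      then obtain i' j' where i': "(i', j') \<in> diagram mu" "?U (i', j') = a + 1" "a + 1 + j' = b + i'"
        unfolding tableau_cells_iff[OF mu U] by auto
      have diag: "j' + i + 1 = j + i'"
        using i'(3) b(1) by simp
      \<comment> \<open>Here the alternatives are weakly south-east of \<open>(i + 1, j)\<close>,
        with entry above \<open>a + 1\<close>, and weakly north-west of \<open>(i, j)\<close>, with
        entry at most \<open>a\<close>.\<close>
      show False
      proof (cases "i < i'")
        case True
        then have r: "(i + 1, j) \<in> diagram mu"
          using diagram_down[OF mu i'(1)] pos diag by simp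
        show False
          using leU[OF r i'(1)] semistandard_add_le[OF mu ss ij(1) r] True diag i'(2) Tij by simp
      next
        case False
        then show False
          using leU[OF i'(1) ij(1)] diag i'(2) by simp
      qed
    qed
    have no_diag: "(a + 1, b + 1) \<notin> tableau_cells mu ?U"
    proof
      assume "(a + 1, b + 1) \<in> tableau_cells mu ?U"
      then obtain i' j' where i': "(i', j') \<in> diagram mu" "?U (i', j') = a + 1" "a + j' = b + i'"
        unfolding tableau_cells_iff[OF mu U] by auto
      have diag: "j' + i = j + i'" and "(i', j') \<noteq> (i, j)"
        using i'(2,3) b(1) by auto
      then have "T (i', j') = T (i, j)" "i \<noteq> i'"
        using i'(2) Tij by auto
      then show False
        using semistandard_add_le[OF mu ss i'(1) ij(1)] semistandard_add_le[OF mu ss ij(1) i'(1)] diag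
        by (cases "i \<le> i'") simp_all
    qed
    have "(a, b) \<in> tableau_cells mu ?U"
      using ij(1) b(1) unfolding tableau_cells_iff[OF mu U] by auto
    then have "active lam (tableau_cells mu ?U) a b"
      using lam_cells end_cell no_right no_below no_diag by (simp add: active_def)
    then have "insert (a + 1, b + 1) (tableau_cells mu ?U - {(a, b)}) \<in> excited_diagrams lam mu"
      using IH by (rule excited_diagrams.move[rotated])
    moreover have "tableau_cells mu (?U((i, j) := a + 1)) =
        insert (a + 1, b + 1) (tableau_cells mu ?U - {(a, b)})"
      unfolding tableau_cells_fun_upd[OF mu U ij(1)] fun_upd_same b(2) b_def[symmetric] by (rule refl)
    moreover have "?U((i, j) := a + 1) = T"
      using Tij(1) by auto
    ultimately show ?thesis
      by simp
  qed
qed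

lemma ED_eq_card_flagged_tableaux:
  assumes "skew_shape lam mu"
  shows "ED lam mu = card (flagged_tableaux lam mu)"
proof -
  have parts: "is_partition lam" "is_partition mu"
    using assms by (simp_all add: skew_shape_def)
  have "excited_diagrams lam mu = tableau_cells mu ` flagged_tableaux lam mu"
    using excited_diagrams_subset_tableau_cells[OF assms] flagged_tableau_excited[OF parts] by blast
  then show ?thesis
    by (simp add: ED_def card_image inj_on_tableau_cells parts)
qed

section \<open>Comparison with Okounkov--Olshanski tableaux\<close>

text \<open>In a flagged tableau the entry \<open>t\<close> of a cell \<open>(i, j)\<close> satisfies
  \<open>t + j - i \<le> part lam t\<close>; the limit is the last column where this can happen.\<close>

definition column_limit :: "nat list \<Rightarrow> nat list \<Rightarrow> nat \<Rightarrow> nat" where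
  "column_limit lam mu t = card {j. \<exists>i. (i, j) \<in> diagram mu \<and> j + t \<le> part lam t + i}"

lemma finite_column_limit_set:
  assumes "is_partition mu"
  shows "finite {j. \<exists>i. (i, j) \<in> diagram mu \<and> j + t \<le> part lam t + i}"
proof -
  have "{j. \<exists>i. (i, j) \<in> diagram mu \<and> j + t \<le> part lam t + i} \<subseteq> snd ` diagram mu"
    by force
  then show ?thesis
    by (rule finite_subset) (simp add: finite_diagram[OF assms])
qed

lemma le_column_limit_iff:
  assumes mu: "is_partition mu" and "1 \<le> j"
  shows "j \<le> column_limit lam mu t \<longleftrightarrow> (\<exists>i. (i, j) \<in> diagram mu \<and> j + t \<le> part lam t + i)"
proof -
  let ?J = "{j. \<exists>i. (i, j) \<in> diagram mu \<and> j + t \<le> part lam t + i}"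
  have "j \<in> ?J \<longleftrightarrow> 1 \<le> j \<and> j \<le> card ?J"
  proof (rule mem_downset_iff_le_card[OF finite_column_limit_set[OF mu]])
    show "1 \<le> j" if "j \<in> ?J" for j
      using that by (auto simp: diagram_iff)
    show "j' \<in> ?J" if j: "j \<in> ?J" "1 \<le> j'" "j' \<le> j" for j j'
    proof -
      obtain i where i: "(i, j) \<in> diagram mu" "j + t \<le> part lam t + i"
        using j(1) by auto
      then have "(i, j') \<in> diagram mu"
        using j by (simp add: diagram_iff)
      moreover have "j' + t \<le> part lam t + i"
        using i(2) j(3) by simp
      ultimately show ?thesis
        by blast
    qed
  qed
  then show ?thesis
    using assms(2) by (simp add: column_limit_def)
qed

text \<open>Since \<open>part lam t - t\<close> decreases with \<open>t\<close>, every cell that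
  witnesses a column for \<open>t\<close> also does so for \<open>s\<close>.\<close>

lemma column_limit_antimono:
  assumes "is_partition lam" and "is_partition mu" and "1 \<le> s" and "s \<le> t"
  shows "column_limit lam mu t \<le> column_limit lam mu s"
proof -
  have "j + s \<le> part lam s + i" if "j + t \<le> part lam t + i" for i j
    using part_antimono[OF assms(1,3,4)] assms(4) that by linarith
  then show ?thesis
    unfolding column_limit_def
    by (intro card_mono finite_column_limit_set[OF assms(2)]) blast
qed

text \<open>A witness in row \<open>i \<le> t\<close> gives the bound directly. A witness further
  down puts \<open>(t, j)\<close> into \<open>mu\<close>, hence into \<open>lam\<close>.\<close>

lemma le_part_of_le_column_limit:
  assumes "skew_shape lam mu" and "1 \<le> t" and "1 \<le> j" and "j \<le> column_limit lam mu t"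
  shows "j \<le> part lam t"
proof -
  have mu: "is_partition mu" and sub: "diagram mu \<subseteq> diagram lam"
    using assms(1) by (simp_all add: skew_shape_def)
  obtain i where i: "(i, j) \<in> diagram mu" "j + t \<le> part lam t + i"
    using assms(3,4) le_column_limit_iff[OF mu] by blast
  show ?thesis
  proof (cases "i \<le> t")
    case True
    then show ?thesis
      using i(2) by simp
  next
    case False
    then have "(t, j) \<in> diagram mu"
      using diagram_down[OF mu i(1)] assms(2,3) by simp
    then have "(t, j) \<in> diagram lam"
      using sub by blast
    then show ?thesis
      by (simp add: diagram_iff)
  qed
qed

lemma flagged_tableaux_subset_limited_tableaux:
  assumes mu: "is_partition mu"
  shows "flagged_tableaux lam mu \<subseteq> limited_tableaux (part mu) (length lam) (column_limit lam mu)"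
proof
  fix T assume T: "T \<in> flagged_tableaux lam mu"
  note D = flagged_tableauxD[OF mu T]
  have "1 \<le> T (i, j) \<and> T (i, j) \<le> length lam \<and> j \<le> column_limit lam mu (T (i, j))"
    if ij: "(i, j) \<in> diagram mu" for i j
  proof (intro conjI)
    have cell: "(T (i, j), T (i, j) + j - i) \<in> diagram lam"
      by (rule D(3)[OF ij])
    then show "1 \<le> T (i, j)" "T (i, j) \<le> length lam"
      by (simp_all add: diagram_def)
    have "j + T (i, j) \<le> part lam (T (i, j)) + i"
      using cell by (auto simp: diagram_iff)
    moreover have "1 \<le> j"
      using ij by (simp add: diagram_iff)
    ultimately show "j \<le> column_limit lam mu (T (i, j))"
      using ij le_column_limit_iff[OF mu] by blast
  qed
  then show "T \<in> limited_tableaux (part mu) (length lam) (column_limit lam mu)"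
    using D(1,2) unfolding limited_tableaux_def semistandard_def diagram_eq_shape[symmetric]
    by (auto simp: PiE_iff)
qed

text \<open>The limits give \<open>j \<le> part lam (d + 1 - t)\<close> with
  \<open>d = length lam\<close>, and \<open>j - i < j\<close> because
  \<open>i \<ge> 1\<close>.\<close>

lemma limited_tableaux_subset_OO_tableaux:
  assumes "skew_shape lam mu"
  shows "limited_tableaux (part mu) (length lam) (\<lambda>t. column_limit lam mu (Suc (length lam) - t))
    \<subseteq> OO_tableaux lam mu"
proof
  fix T assume T: "T \<in> limited_tableaux (part mu) (length lam) (\<lambda>t. column_limit lam mu (Suc (length lam) - t))"
  have "int j - int i < int (part lam (length lam + 1 - T (i, j)))" if ij: "(i, j) \<in> diagram mu" for i j
  proof -
    have "T (i, j) \<in> {1..length lam}" "j \<le> column_limit lam mu (Suc (length lam) - T (i, j))"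
      using T ij by (auto simp: limited_tableaux_def diagram_eq_shape)
    moreover have "1 \<le> i" "1 \<le> j"
      using ij by (simp_all add: diagram_iff)
    ultimately have "j \<le> part lam (Suc (length lam) - T (i, j))"
      by (intro le_part_of_le_column_limit[OF assms]) auto
    then show ?thesis
      using \<open>1 \<le> i\<close> by simp
  qed
  then show "T \<in> OO_tableaux lam mu"
    using T unfolding OO_tableaux_def limited_tableaux_def semistandard_def diagram_eq_shape[symmetric]
    by auto
qed

section \<open>Inequality, equality and strictness\<close>

lemma finite_OO_tableaux:
  assumes "is_partition mu"
  shows "finite (OO_tableaux lam mu)"
proof (rule finite_subset)
  show "OO_tableaux lam mu \<subseteq> diagram mu \<rightarrow>\<^sub>E {1..length lam}"
    by (auto simp: OO_tableaux_def)
  show "finite (diagram mu \<rightarrow>\<^sub>E {1..length lam})"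
    using finite_diagram[OF assms] by (intro finite_PiE) auto
qed

text \<open>The estimate stops at the reversed limits rather than at \<open>OOT\<close>, so that one
  Okounkov--Olshanski tableau violating these limits yields strictness.\<close>

lemma ED_le_card_limited_tableaux:
  assumes "skew_shape lam mu"
  shows "ED lam mu \<le>
    card (limited_tableaux (part mu) (length lam) (\<lambda>t. column_limit lam mu (Suc (length lam) - t)))"
proof -
  have parts: "is_partition lam" "is_partition mu"
    using assms by (simp_all add: skew_shape_def)
  have "ED lam mu \<le> card (limited_tableaux (part mu) (length lam) (column_limit lam mu))"
    unfolding ED_eq_card_flagged_tableaux[OF assms]
    by (intro card_mono flagged_tableaux_subset_limited_tableaux finite_limited_tableaux partition_fun_part parts)
  also have "\<dots> \<le> card (limited_tableaux (part mu) (length lam) (\<lambda>t. column_limit lam mu (Suc (length lam) - t)))"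
    by (intro card_limited_tableaux_le_reversed partition_fun_part parts column_limit_antimono)
  finally show ?thesis .
qed

text \<open>The entrywise smallest Okounkov--Olshanski tableau: column \<open>j\<close> starts right after the
  rows missing from column \<open>j\<close> of \<open>lam\<close>.\<close>

lemma OO_tableau_starting_with_ones:
  assumes "skew_shape lam mu"
  obtains T where "T \<in> OO_tableaux lam mu"
    and "\<And>j. (1, j) \<in> diagram mu \<Longrightarrow> j \<le> part lam (length lam) \<Longrightarrow> T (1, j) = 1"
proof
  have lam: "is_partition lam" and mu: "is_partition mu" and sub: "diagram mu \<subseteq> diagram lam"
    using assms by (simp_all add: skew_shape_def)
  define d where "d = length lam"
  define h where "h j = card {t. (t, j) \<in> diagram lam}" for j
  have fin: "finite {t. (t, j) \<in> diagram lam}" for j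
    by (rule finite_subset[of _ "{..length lam}"]) (auto simp: diagram_def)
  have h_iff: "(t, j) \<in> diagram lam \<longleftrightarrow> 1 \<le> t \<and> t \<le> h j" for t j
  proof -
    have "t \<in> {t. (t, j) \<in> diagram lam} \<longleftrightarrow> 1 \<le> t \<and> t \<le> h j"
      unfolding h_def
    proof (rule mem_downset_iff_le_card[OF fin])
      show "1 \<le> t" if "t \<in> {t. (t, j) \<in> diagram lam}" for t
        using that by (simp add: diagram_iff)
      show "t' \<in> {t. (t, j) \<in> diagram lam}"
        if "t \<in> {t. (t, j) \<in> diagram lam}" "1 \<le> t'" "t' \<le> t" for t t'
        using that diagram_down[OF lam, of t j t' j] by (simp add: diagram_iff)
    qed
    then show ?thesis
      by simp
  qed
  have h_le: "h j \<le> d" if "1 \<le> h j" for j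
    using h_iff[of "h j" j] that by (simp add: diagram_def d_def)
  have i_le: "1 \<le> i" "i \<le> h j" "h j \<le> d" if "(i, j) \<in> diagram mu" for i j
    using h_iff[of i j] h_le[of j] sub that by auto
  have h_anti: "h j' \<le> h j" if "1 \<le> j" "j \<le> j'" for j j'
    using diagram_down[OF lam, of "h j'" j' "h j'" j] h_iff[of "h j'"] that by (cases "h j' = 0") auto
  let ?T = "\<lambda>(i, j)\<in>diagram mu. d - h j + i"
  have "?T \<in> diagram mu \<rightarrow>\<^sub>E {1..length lam}"
  proof -
    have "1 \<le> d - h j + i \<and> d - h j + i \<le> length lam" if "(i, j) \<in> diagram mu" for i j
      using i_le[OF that] unfolding d_def by linarith
    then show ?thesis
      by (auto simp: PiE_iff)
  qed
  moreover have "semistandard mu ?T"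
    unfolding semistandard_def using h_anti by (auto simp: diagram_iff diff_le_mono2)
  moreover have "int j - int i < int (part lam (length lam + 1 - ?T (i, j)))"
    if ij: "(i, j) \<in> diagram mu" for i j
  proof -
    \<comment> \<open>The entry reflects to row \<open>h j + 1 - i\<close>, which still meets column
      \<open>j\<close> of \<open>lam\<close>.\<close>
    have "length lam + 1 - ?T (i, j) = h j + 1 - i"
      using i_le[OF ij] ij d_def by simp
    moreover have "(h j + 1 - i, j) \<in> diagram lam"
      using i_le[OF ij] by (auto simp: h_iff)
    ultimately show ?thesis
      using i_le(1)[OF ij] by (simp add: diagram_iff)
  qed
  ultimately show "?T \<in> OO_tableaux lam mu"
    unfolding OO_tableaux_def by blast
  show "?T (1, j) = 1" if j: "(1, j) \<in> diagram mu" "j \<le> part lam (length lam)" for j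
  proof -
    have "1 \<le> j"
      using j(1) by (simp add: diagram_iff)
    moreover have "1 \<le> d"
      using i_le[OF j(1)] by simp
    ultimately have "(d, j) \<in> diagram lam"
      using j(2) by (simp add: diagram_iff d_def)
    then have "d \<le> h j"
      by (simp add: h_iff)
    then show ?thesis
      using j(1) by simp
  qed
qed

text \<open>Every column of \<open>mu\<close> reaches row \<open>r\<close>, so entries in row
  \<open>i\<close> are at most \<open>d - r + i\<close>, where \<open>d = length lam\<close>. The
  inequality \<open>cond\<close> then makes both side conditions automatic.\<close>

lemma flagged_tableaux_eq_OO_tableaux:
  assumes shape: "skew_shape lam mu" and r: "1 \<le> r" "r \<le> length lam" "part mu r = part mu 1"
    and cond: "part mu r + length lam \<le> part lam (length lam) + r"
  shows "flagged_tableaux lam mu = OO_tableaux lam mu"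
proof -
  have lam: "is_partition lam" and mu: "is_partition mu"
    using shape by (simp_all add: skew_shape_def)
  have last: "part lam (length lam) \<le> part lam t" if "1 \<le> t" "t \<le> length lam" for t
    using part_antimono[OF lam that] .
  have col: "1 \<le> i" "1 \<le> j" "j \<le> part mu 1" if "(i, j) \<in> diagram mu" for i j
    using that part_antimono[OF mu, of 1 i] by (auto simp: diagram_iff)
  have flag: "(T (i, j), T (i, j) + j - i) \<in> diagram lam"
    if T: "semistandard mu T" "\<And>c. c \<in> diagram mu \<Longrightarrow> 1 \<le> T c \<and> T c \<le> length lam"
      and ij: "(i, j) \<in> diagram mu" for T i j
  proof -
    have first: "(1, j) \<in> diagram mu" and rj: "(r, j) \<in> diagram mu"
      using col[OF ij] r by (simp_all add: diagram_iff)
    have "i \<le> T (i, j)"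
      using semistandard_add_le[OF mu T(1) first ij] col[OF ij] T(2)[OF first] by auto
    moreover have "T (i, j) + r \<le> length lam + i"
      using semistandard_add_le[OF mu T(1) ij rj] T(2)[OF rj] T(2)[OF ij] by (cases "i \<le> r") auto
    then have "T (i, j) + j \<le> part lam (T (i, j)) + i"
      using cond last[of "T (i, j)"] T(2)[OF ij] col(3)[OF ij] r(3) by simp
    ultimately show ?thesis
      using T(2)[OF ij] col[OF ij] by (auto simp: diagram_iff)
  qed
  have bound: "int j - int i < int (part lam (length lam + 1 - T (i, j)))"
    if "(i, j) \<in> diagram mu" "1 \<le> T (i, j) \<and> T (i, j) \<le> length lam" for T i j
  proof -
    have "part lam (length lam) \<le> part lam (length lam + 1 - T (i, j))"
      by (rule last) (use that(2) in auto)
    \<comment> \<open>This uses \<open>r \<le> length lam\<close> in \<open>cond\<close>.\<close>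
    then have "part mu 1 \<le> part lam (length lam + 1 - T (i, j))"
      using cond r by simp
    then show ?thesis
      using col[OF that(1)] by simp
  qed
  show ?thesis
  proof (intro equalityI subsetI)
    fix T assume T: "T \<in> flagged_tableaux lam mu"
    have "1 \<le> T (i, j) \<and> T (i, j) \<le> length lam" if "(i, j) \<in> diagram mu" for i j
      using flagged_tableauxD(3)[OF mu T that] by (simp add: diagram_def)
    then show "T \<in> OO_tableaux lam mu"
      using bound flagged_tableauxD(1,2)[OF mu T] by (auto simp: OO_tableaux_def PiE_iff)
  next
    fix T assume "T \<in> OO_tableaux lam mu"
    then have T: "semistandard mu T" "T \<in> extensional (diagram mu)"
        "\<And>c. c \<in> diagram mu \<Longrightarrow> 1 \<le> T c \<and> T c \<le> length lam"
      by (auto simp: OO_tableaux_def PiE_iff)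
    then show "T \<in> flagged_tableaux lam mu"
      using flag[OF T(1,3)] by (auto simp: flagged_tableaux_def)
  qed
qed

text \<open>The smallest Okounkov--Olshanski tableau has a 1 at \<open>(1, j)\<close> in a column
  \<open>j\<close> beyond the limit of row \<open>length lam\<close>, which is the reversed limit
  for entry 1.\<close>

lemma ED_less_OOT:
  assumes shape: "skew_shape lam mu" and "mu \<noteq> []"
    and last: "part mu (length lam) < part lam (length lam)"
    and r: "\<And>i. 1 \<le> i \<Longrightarrow> part mu 1 \<le> part mu i \<Longrightarrow> i \<le> r"
    and cond: "part lam (length lam) + r < part mu 1 + length lam"
  shows "ED lam mu < OOT lam mu"
proof -
  have mu: "is_partition mu"
    using shape by (simp add: skew_shape_def)
  let ?d = "length lam"
  let ?L = "limited_tableaux (part mu) ?d (\<lambda>t. column_limit lam mu (Suc ?d - t))"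
  obtain T where T: "T \<in> OO_tableaux lam mu"
    and ones: "\<And>j. (1, j) \<in> diagram mu \<Longrightarrow> j \<le> part lam ?d \<Longrightarrow> T (1, j) = 1"
    using OO_tableau_starting_with_ones[OF shape] by blast
  \<comment> \<open>The last column of the first row of \<open>mu\<close> in which the smallest
    tableau is known to have entry 1.\<close>
  define j where "j = min (part lam ?d) (part mu 1)"
  have "1 \<le> part mu 1"
    using mu \<open>mu \<noteq> []\<close> by (cases mu) (auto simp: part_def is_partition_def)
  then have j: "1 \<le> j" "j \<le> part lam ?d" "(1, j) \<in> diagram mu"
    using last by (auto simp: j_def diagram_iff)
  have "\<not> j \<le> column_limit lam mu ?d"
  proof
    assume "j \<le> column_limit lam mu ?d"
    then obtain i where i: "(i, j) \<in> diagram mu" "j + ?d \<le> part lam ?d + i"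
      using le_column_limit_iff[OF mu j(1)] by blast
    show False
    \<comment> \<open>If \<open>j = part lam ?d\<close>, a witness lies in row \<open>?d\<close> or
      lower, so the last row of \<open>lam\<close> would be filled by \<open>mu\<close>. If
      \<open>j = part mu 1\<close>, it lies in row \<open>r\<close> or higher, against
      \<open>cond\<close>.\<close>
    proof (cases "part lam ?d \<le> part mu 1")
      case True
      then have "j = part lam ?d" "?d \<le> i"
        using i(2) by (auto simp: j_def)
      moreover have "1 \<le> ?d"
        using last by (cases lam) (simp_all add: part_def)
      ultimately have "part lam ?d \<le> part mu ?d"
        using diagram_down[OF mu i(1), of ?d j] j(1) by (simp add: diagram_iff)
      then show False
        using last by simp
    next
      case False
      then have jm: "j = part mu 1"
        by (simp add: j_def)
      then have "i \<le> r"
        using i(1) by (intro r) (simp_all add: diagram_iff)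
      then show False
        using i(2) jm cond by simp
    qed
  qed
  moreover have "j \<le> column_limit lam mu ?d" if "T \<in> ?L"
  proof -
    have "\<forall>(i, j)\<in>diagram mu. j \<le> column_limit lam mu (Suc ?d - T (i, j))"
      using that by (simp add: limited_tableaux_def diagram_eq_shape)
    then show ?thesis
      using ones[OF j(3,2)] j(3) by fastforce
  qed
  ultimately have "T \<notin> ?L"
    by blast
  then have "?L \<subset> OO_tableaux lam mu"
    using limited_tableaux_subset_OO_tableaux[OF shape] T by blast
  then have "card ?L < OOT lam mu"
    unfolding OOT_def by (rule psubset_card_mono[OF finite_OO_tableaux[OF mu]])
  then show ?thesis
    using ED_le_card_limited_tableaux[OF shape] by simp
qed

theorem theorem1p7:
  fixes lam mu :: "nat list" and d r :: nat
  assumes "connected_skew_shape lam mu"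
    and "mu \<noteq> []"
    and "d = length lam"
    and "r = Max {i. 1 \<le> i \<and> i \<le> length mu \<and> part mu i = part mu 1}"
  shows "ED lam mu \<le> OOT lam mu \<and>
    (ED lam mu = OOT lam mu \<longleftrightarrow> int (part lam d) \<ge> int (part mu r) + int d - int r)"
proof -
  have shape: "skew_shape lam mu" and last: "part mu d < part lam d"
    using assms(1,3) by (simp_all add: connected_skew_shape_def)
  have mu: "is_partition mu" and sub: "diagram mu \<subseteq> diagram lam"
    using shape by (simp_all add: skew_shape_def)
  let ?R = "{i. 1 \<le> i \<and> i \<le> length mu \<and> part mu i = part mu 1}"
  have fin: "finite ?R"
    by (rule finite_subset[of _ "{..length mu}"]) auto
  have "1 \<in> ?R"
    using \<open>mu \<noteq> []\<close> by (cases mu) auto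
  then have "r \<in> ?R"
    unfolding assms(4) using fin by (intro Max_in) auto
  then have r: "1 \<le> r" "r \<le> length mu" "part mu r = part mu 1"
    by auto
  have pos: "1 \<le> part mu i" if "1 \<le> i" "i \<le> length mu" for i
    using mu that by (auto simp: part_def is_partition_def Suc_le_eq)
  have rmax: "i \<le> r" if i: "1 \<le> i" "part mu 1 \<le> part mu i" for i
  proof -
    have "i \<le> length mu"
      using pos[of 1] i r by (cases "i \<le> length mu") (auto simp: part_def)
    moreover have "part mu i = part mu 1"
      using part_antimono[OF mu _ i(1)] i(2) by simp
    ultimately show ?thesis
      unfolding assms(4) using fin i(1) by (intro Max_ge) auto
  qed
  \<comment> \<open>Containment of the diagrams gives \<open>r \<le> d\<close>, which the equality
    case needs.\<close>
  have "(r, 1) \<in> diagram mu"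
    using pos[OF r(1,2)] r(1) by (simp add: diagram_iff)
  then have "(r, 1) \<in> diagram lam"
    using sub by blast
  then have "r \<le> d"
    by (simp add: diagram_def assms(3))
  show ?thesis
  proof (cases "part mu r + d \<le> part lam d + r")
    case True
    then have "flagged_tableaux lam mu = OO_tableaux lam mu"
      using r \<open>r \<le> d\<close> assms(3) by (intro flagged_tableaux_eq_OO_tableaux[OF shape, of r]) simp_all
    then have "ED lam mu = OOT lam mu"
      by (simp add: ED_eq_card_flagged_tableaux[OF shape] OOT_def)
    then show ?thesis
      using True by auto
  next
    case False
    then have "ED lam mu < OOT lam mu"
      using last rmax r(3) assms(3) by (intro ED_less_OOT[OF shape \<open>mu \<noteq> []\<close>]) auto
    then show ?thesis
      using False by auto
  qed
qed

end
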